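(* Let $\delta>0$ and $y^\delta$ be fixed and let $1<\tau<\lambda$. Then there exist $m\in\mathbb{N}$ and $\alpha>0$ such that $$\tau\delta\le\|F(x^\delta_{m,\alpha})-y^\delta\|\le\lambda\delta$$ holds for some minimizer $x^\delta_{m,\alpha}$ of $\mathcal{F}^{y^\delta}_{\alpha,x_0}$ over $\mathcal{D}_m$ (with these same $m$ and $\alpha$).
   Context: Setting. $X,Y$ are reflexive Banach spaces, $F:\mathcal{D}(F)\subset X\to Y$ has convex domain $\mathcal{D}(F)$, $y\in\mathcal{R}(F)$ (the range of $F$) is the noiseless data, $y^\delta\in Y$ is noisy data with noise level $\delta>0$, $\|y-y^\delta\|\le\delta$; $1\le p<\infty$; $x_0\in\mathcal{D}(F)$ is fixed. For $\alpha>0$, $\mathcal{F}^{y^\delta}_{\alpha,x_0}(x)=\|F(x)-y^\delta\|^p+\alpha f_{x_0}(x)$. Standing assumptions. (1) $f_{x_0}:\mathcal{D}(f_{x_0})\to\mathbb{R}_+$ is weakly lower semi-continuous, convex, coercive and proper, and $\mathcal{D}(F)$ lies in the interior of $\mathcal{D}(f_{x_0})$. (2) $F$ is continuous for the strong topologies of $X$ and $Y$; the level sets $\mathcal{M}_\alpha(\rho)=\{x\in\mathcal{D}(F):\mathcal{F}^{y^\delta}_{\alpha,x_0}(x)\le\rho\}$ are weakly pre-compact and weakly closed, and $F$ restricted to $\mathcal{M}_\alpha(\rho)$ is continuous for the weak topologies of $X$ and $Y$. (3) If $x^\dagger$ is an $f_{x_0}$-minimizing solution, then $\liminf_{t\to0^+}\|F((1-t)x^\dagger+tx_0)-y\|^p/t=0$.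 Here $\mathcal{LS}=\{x\in\mathcal{D}(F):\|F(x)-y\|=0\}$ is the set of least-square solutions, and an $f_{x_0}$-minimizing solution is an element of $\mathcal{L}=\operatorname{argmin}\{f_{x_0}(x):x\in\mathcal{LS}\}$; it is assumed that $\mathcal{L}\ne\emptyset$. Discretization. $\{X_m\}_{m\in\mathbb{N}}$ are finite-dimensional subspaces of $X$ with $X_m\subset X_{m+1}$ and $\overline{\bigcup_m X_m}=X$; $\mathcal{D}_m=\mathcal{D}(F)\cap X_m$, assumed nonempty for every $m$. $P_m:X\to\mathcal{D}_m$ is the projection onto $\mathcal{D}_m$ ($P_mx$ is a point of $\mathcal{D}_m$ nearest to $x$), $x^\dagger$ is a fixed $f_{x_0}$-minimizing solution, and $\gamma_m=\|F(x^\dagger)-F(P_mx^\dagger)\|$. $M_{\alpha,m}$ denotes the set of minimizers of $\mathcal{F}^{y^\delta}_{\alpha,x_0}$ over $\mathcal{D}_m$. Further standing assumptions. $f_{x_0}(x)=0$ if and only if $x=x_0$. There is $m_0$ with $x_0\in\mathcal{D}_{m_0}$, and only $m\ge m_0$ are considered. With $\tau_1=\tau$ and $\tau_2$ fixed, $1<\tau_1\le\tau_2<\lambda$: for each $m$ there is no $\alpha>0$ for which there exist $\underline{x},\overline{x}\in M_{\alpha,m}$ with $\|F(\underline{x})-y^\delta\|<\tau_1(\delta+\gamma_m)\le\tau_2(\delta+\gamma_m)<\|F(\overline{x})-y^\delta\|$.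
   Formalization: Two hypotheses are added, without either of which the claim can fail: $\tau\delta<\|F(x_0)-y^\delta\|$, and $x^\dagger$ lies in the closure of $\bigcup_m\mathcal{D}_m$ (density of the $X_m$ in $X$ does not give this). *)

theory Defs
  imports "HOL-Analysis.Analysis"
begin

definition reflexive_space :: "'a::real_normed_vector itself \<Rightarrow> bool" where
  "reflexive_space (_ :: 'a itself) \<longleftrightarrow>
     (\<forall>\<phi> :: ('a \<Rightarrow>\<^sub>L real) \<Rightarrow>\<^sub>L real. \<exists>x :: 'a. \<forall>g. blinfun_apply \<phi> g = blinfun_apply g x)"

definition weak_topology :: "'a::real_normed_vector topology" where
  "weak_topology =
     topology_generated_by {blinfun_apply g -` U | (g :: 'a \<Rightarrow>\<^sub>L real) U. open U}"

definition weakly_closed :: "'a::real_normed_vector set \<Rightarrow> bool" where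
  "weakly_closed S \<longleftrightarrow> closedin weak_topology S"

definition weakly_precompact :: "'a::real_normed_vector set \<Rightarrow> bool" where
  "weakly_precompact S \<longleftrightarrow> compactin weak_topology (weak_topology closure_of S)"

definition weakly_continuous_on ::
    "'a::real_normed_vector set \<Rightarrow> ('a \<Rightarrow> 'b::real_normed_vector) \<Rightarrow> bool" where
  "weakly_continuous_on S F \<longleftrightarrow> continuous_map (subtopology weak_topology S) weak_topology F"

(* A partial map D(f) -> R is a total function together with the set D; semicontinuity is
   relative to D. *)
definition weakly_lsc_on :: "'a::real_normed_vector set \<Rightarrow> ('a \<Rightarrow> real) \<Rightarrow> bool" where
  "weakly_lsc_on D f \<longleftrightarrow> (\<forall>c. openin (subtopology weak_topology D) {x \<in> D. c < f x})"

definition coercive_on :: "'a::real_normed_vector set \<Rightarrow> ('a \<Rightarrow> real) \<Rightarrow> bool" where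
  "coercive_on D f \<longleftrightarrow> filterlim f at_top (inf at_infinity (principal D))"

(* Values are finite on D, so only the effective domain has to be nonempty. *)
definition proper_on :: "'a set \<Rightarrow> ('a \<Rightarrow> real) \<Rightarrow> bool" where
  "proper_on D f \<longleftrightarrow> D \<noteq> {}"

definition tikhonov ::
    "('a \<Rightarrow> 'b::real_normed_vector) \<Rightarrow> ('a \<Rightarrow> real) \<Rightarrow> real \<Rightarrow> 'b \<Rightarrow> real \<Rightarrow> 'a \<Rightarrow> real" where
  "tikhonov F f p yd \<alpha> x = norm (F x - yd) powr p + \<alpha> * f x"

definition level_set ::
    "'a set \<Rightarrow> ('a \<Rightarrow> 'b::real_normed_vector) \<Rightarrow> ('a \<Rightarrow> real) \<Rightarrow> real \<Rightarrow> 'b \<Rightarrow> real \<Rightarrow> real \<Rightarrow> 'a set" where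
  "level_set DF F f p yd \<alpha> \<rho> = {x \<in> DF. tikhonov F f p yd \<alpha> x \<le> \<rho>}"

definition minimizers :: "'a set \<Rightarrow> ('a \<Rightarrow> real) \<Rightarrow> 'a set" where
  "minimizers D J = {x. is_arg_min J (\<lambda>x. x \<in> D) x}"

definition least_square_solutions ::
    "'a set \<Rightarrow> ('a \<Rightarrow> 'b::real_normed_vector) \<Rightarrow> 'b \<Rightarrow> 'a set" where
  "least_square_solutions DF F y = {x \<in> DF. norm (F x - y) = 0}"

definition f_minimizing_solutions ::
    "'a set \<Rightarrow> ('a \<Rightarrow> 'b::real_normed_vector) \<Rightarrow> ('a \<Rightarrow> real) \<Rightarrow> 'b \<Rightarrow> 'a set" where
  "f_minimizing_solutions DF F f y = minimizers (least_square_solutions DF F y) f"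

definition is_projection_onto :: "'a::metric_space set \<Rightarrow> ('a \<Rightarrow> 'a) \<Rightarrow> bool" where
  "is_projection_onto S P \<longleftrightarrow> (\<forall>x. P x \<in> S \<and> (\<forall>z\<in>S. dist x (P x) \<le> dist x z))"

end

theory Submission
  imports Defs
begin

text \<open>
  Fix \<open>m\<close> so large that \<open>\<tau>\<^sub>2 (\<delta> + \<gamma> m) \<le> lam * \<delta>\<close> and \<open>\<tau> (\<delta> + \<gamma> m) < \<parallel>F x0 - yd\<parallel>\<close>. In the
  finite-dimensional set \<open>D m\<close> the sublevel sets of the functional are norm compact, so limits of
  minimizers for \<open>\<alpha>\<^sub>k \<longlongrightarrow> \<alpha> > 0\<close> are minimizers for \<open>\<alpha>\<close>. The residual of every minimizer is
  below \<open>T = \<tau> (\<delta> + \<gamma> m)\<close> for small \<open>\<alpha>\<close> (compare with \<open>P m xdag\<close>) and above \<open>T\<close> for large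
  \<open>\<alpha>\<close> (the minimizers tend to \<open>x0\<close>). At the supremum of the parameters that admit a
  minimizer with residual below \<open>T\<close>, approximation from the left gives a minimizer with residual
  at most \<open>T\<close>. If no residual lay in \<open>[T, T\<^sub>2]\<close> with \<open>T\<^sub>2 = \<tau>\<^sub>2 (\<delta> + \<gamma> m)\<close>, approximation from the right
  would give one with residual at least \<open>T\<^sub>2\<close>, contradicting the absence of jumps.
\<close>

section \<open>Passing from weak topology and coercivity to norm topology\<close>

lemma openin_weak_topology_imp_open:
  assumes "openin weak_topology U"
  shows "open U"
proof -
  have "generate_topology_on {blinfun_apply g -` V | (g :: 'a \<Rightarrow>\<^sub>L real) V. open V} U"
    using assms by (simp add: weak_topology_def openin_topology_generated_by_iff)
  then show ?thesis
  proof induction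
    case (Basis s)
    then obtain g :: "'a \<Rightarrow>\<^sub>L real" and V where "s = blinfun_apply g -` V" "open V"
      by blast
    then show ?case
      by (simp add: open_vimage linear_continuous_on blinfun.bounded_linear_right)
  qed auto
qed

lemma topspace_weak_topology: "topspace weak_topology = (UNIV :: 'a::real_normed_vector set)"
proof -
  have "openin weak_topology (UNIV :: 'a set)"
    unfolding weak_topology_def openin_topology_generated_by_iff
    by (rule generate_topology_on.Basis) (auto intro!: exI[of _ UNIV])
  then show ?thesis
    using openin_subset by blast
qed

lemma weakly_closed_imp_closed:
  assumes "weakly_closed S"
  shows "closed S"
proof -
  have "openin weak_topology (UNIV - S)"
    using assms by (simp add: weakly_closed_def closedin_def topspace_weak_topology)
  then have "open (UNIV - S)"
    by (rule openin_weak_topology_imp_open)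
  then show ?thesis
    by (simp only: closed_def Compl_eq_Diff_UNIV)
qed

lemma weakly_lsc_on_imp_openin:
  assumes "weakly_lsc_on A f" "S \<subseteq> A"
  shows "openin (top_of_set S) {x \<in> S. c < f x}"
proof -
  obtain U where U: "openin weak_topology U" "{x \<in> A. c < f x} = U \<inter> A"
    using assms(1) by (auto simp: weakly_lsc_on_def openin_subtopology)
  have "{x \<in> S. c < f x} = S \<inter> U"
    using U(2) assms(2) by auto
  then show ?thesis
    using openin_weak_topology_imp_open[OF U(1)] by (auto simp: openin_open)
qed

lemma coercive_on_imp_bounded_sublevel:
  fixes f :: "'a::real_normed_vector \<Rightarrow> real"
  assumes "coercive_on A f"
  shows "bounded {x \<in> A. f x \<le> c}"
proof -
  \<comment> \<open>Divergence yields non-strict bounds, so the level \<open>c + 1\<close> is used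
    to exclude \<open>f x \<le> c\<close>.\<close>
  have "\<forall>\<^sub>F x in at_infinity. x \<in> A \<longrightarrow> c + 1 \<le> f x"
    using assms by (simp add: coercive_on_def filterlim_at_top eventually_inf_principal)
  then obtain b where b: "\<And>x. b \<le> norm x \<Longrightarrow> x \<in> A \<Longrightarrow> c + 1 \<le> f x"
    by (auto simp: eventually_at_infinity)
  have "norm x \<le> b" if "x \<in> A" "f x \<le> c" for x
    using b[of x] that by fastforce
  then show ?thesis
    by (auto simp: bounded_iff)
qed

section \<open>Compactness in finite-dimensional spans\<close>

lemma closed_if_compact_Int_cball:
  fixes S :: "'a::real_normed_vector set"
  assumes "\<And>r. compact (cball 0 r \<inter> S)"
  shows "closed S"
proof -
  have "l \<in> S" if x: "\<forall>n. x n \<in> S" "x \<longlonglongrightarrow> l" for x l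
  proof -
    obtain r where r: "\<And>n. norm (x n) \<le> r"
      using convergent_imp_bounded[OF x(2)] by (auto simp: bounded_iff)
    have "closed (cball 0 r \<inter> S)"
      using assms compact_imp_closed by blast
    then have "l \<in> cball 0 r \<inter> S"
      by (rule closed_sequentially) (use x r in auto)
    then show ?thesis by blast
  qed
  then show ?thesis
    by (auto simp: closed_sequential_limits)
qed

text \<open>Induction on the spanning set. By the induction hypothesis for all radii,
  \<open>span B\<close> is closed, so a new vector \<open>b\<close> outside it has positive distance
  \<open>d\<close> from it. This distance controls the coefficient of \<open>b\<close>, and the ball
  becomes a closed part of a continuous image of a compact product.\<close>

lemma compact_cball_Int_span:
  fixes B :: "'a::real_normed_vector set"
  assumes "finite B"
  shows "compact (cball 0 r \<inter> span B)"
  using assms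
proof (induction B arbitrary: r rule: finite_induct)
  case empty
  have "cball 0 r \<inter> span {} = (if 0 \<le> r then {0} else {} :: 'a set)"
    by auto
  then show ?case by simp
next
  case (insert b B)
  have cl: "closed (span B)"
    using insert.IH by (rule closed_if_compact_Int_cball)
  show ?case
  proof (cases "b \<in> span B")
    case True
    then show ?thesis
      using insert.IH by (simp add: span_redundant)
  next
    case False
    define d where "d = infdist b (span B)"
    have d: "0 < d"
      using in_closed_iff_infdist_zero[OF cl, of b] infdist_nonneg[of b "span B"] False span_zero[of B]
      by (fastforce simp: d_def)
    \<comment> \<open>Dividing by \<open>t\<close> turns the norm into the distance from
      \<open>b\<close> to a point of \<open>span B\<close>.\<close>
    have lower: "\<bar>t\<bar> * d \<le> norm (t *\<^sub>R b + s)" if s: "s \<in> span B" for t s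
    proof (cases "t = 0")
      case False
      have "d \<le> dist b (- (1 / t) *\<^sub>R s)"
        unfolding d_def by (rule infdist_le) (use s in \<open>rule span_scale\<close>)
      then have "\<bar>t\<bar> * d \<le> \<bar>t\<bar> * norm (b + (1 / t) *\<^sub>R s)"
        by (intro mult_left_mono) (auto simp: dist_norm)
      also have "\<dots> = norm (t *\<^sub>R (b + (1 / t) *\<^sub>R s))"
        by simp
      also have "t *\<^sub>R (b + (1 / t) *\<^sub>R s) = t *\<^sub>R b + s"
        using False by (simp add: scaleR_right_distrib)
      finally show ?thesis .
    qed simp
    \<comment> \<open>\<open>lower\<close> bounds the coefficient by \<open>r / d\<close>, and the
      triangle inequality then bounds the remainder in \<open>span B\<close>. The image of
      \<open>K\<close> may overshoot the ball, hence the later intersection with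
      \<open>cball 0 r\<close>.\<close>
    define K where "K = {- (r / d)..r / d} \<times> (cball 0 (r + r / d * norm b) \<inter> span B)"
    define h where "h = (\<lambda>(t, s). t *\<^sub>R b + s)"
    have "compact K"
      unfolding K_def by (intro compact_Times insert.IH) auto
    then have "compact (h ` K)"
      unfolding h_def case_prod_unfold by (intro compact_continuous_image continuous_intros)
    moreover have "cball 0 r \<inter> span (insert b B) = h ` K \<inter> cball 0 r"
    proof (intro equalityI subsetI)
      fix x
      assume x: "x \<in> cball 0 r \<inter> span (insert b B)"
      then obtain t where t: "x - t *\<^sub>R b \<in> span B"
        by (auto simp: span_insert)
      define s where "s = x - t *\<^sub>R b"
      have "\<bar>t\<bar> * d \<le> r"
        using lower[OF t, of t] x by simp
      then have tr: "\<bar>t\<bar> \<le> r / d"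
        using d by (simp add: field_simps)
      have "norm s \<le> norm x + \<bar>t\<bar> * norm b"
        using norm_triangle_ineq4[of x "t *\<^sub>R b"] by (simp add: s_def)
      also have "\<dots> \<le> r + r / d * norm b"
        using x tr by (intro add_mono mult_right_mono) auto
      finally have "(t, s) \<in> K"
        using tr t by (auto simp: K_def s_def)
      moreover have "x = h (t, s)"
        by (simp add: h_def s_def)
      ultimately show "x \<in> h ` K \<inter> cball 0 r"
        using x by blast
    next
      fix x
      assume "x \<in> h ` K \<inter> cball 0 r"
      moreover have "t *\<^sub>R b + s \<in> span (insert b B)" if "s \<in> span B" for t s
        using that span_mono[OF subset_insertI] by (intro span_add span_scale) (auto simp: span_base)
      ultimately show "x \<in> cball 0 r \<inter> span (insert b B)"
        by (auto simp: K_def h_def)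
    qed
    ultimately show ?thesis
      by (simp add: compact_Int_closed)
  qed
qed

section \<open>Minimizers of a penalized residual with compact sublevel sets\<close>

locale regularized_problem =
  fixes S :: "'a::metric_space set" and r f :: "'a \<Rightarrow> real" and p :: real and x0 :: 'a
  assumes exponent_pos: "0 < p"
    and residual_nonneg: "\<And>x. x \<in> S \<Longrightarrow> 0 \<le> r x"
    and residual_continuous: "continuous_on S r"
    and penalty_nonneg: "\<And>x. x \<in> S \<Longrightarrow> 0 \<le> f x"
    and penalty_lsc: "\<And>c. openin (top_of_set S) {x \<in> S. c < f x}"
    and penalty_zero_iff: "\<And>x. x \<in> S \<Longrightarrow> f x = 0 \<longleftrightarrow> x = x0"
    and x0_in: "x0 \<in> S"
    and sublevel_compact:
      "\<And>\<alpha> \<rho>. 0 < \<alpha> \<Longrightarrow> 0 < \<rho> \<Longrightarrow> compact {x \<in> S. r x powr p + \<alpha> * f x \<le> \<rho>}"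
begin

definition J :: "real \<Rightarrow> 'a \<Rightarrow> real" where
  "J \<alpha> x = r x powr p + \<alpha> * f x"

lemma J_mono: "x \<in> S \<Longrightarrow> \<alpha> \<le> \<beta> \<Longrightarrow> J \<alpha> x \<le> J \<beta> x"
  by (simp add: J_def mult_right_mono penalty_nonneg)

lemma J_nonneg: "x \<in> S \<Longrightarrow> 0 \<le> \<alpha> \<Longrightarrow> 0 \<le> J \<alpha> x"
  by (simp add: J_def penalty_nonneg)

lemma minimizers_iff: "x \<in> minimizers S (J \<alpha>) \<longleftrightarrow> x \<in> S \<and> (\<forall>z\<in>S. J \<alpha> x \<le> J \<alpha> z)"
  by (auto simp: minimizers_def is_arg_min_linorder)

lemma residual_tendsto:
  assumes "\<And>k. x k \<in> S" "l \<in> S" "x \<longlonglongrightarrow> l"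
  shows "(\<lambda>k. r (x k)) \<longlonglongrightarrow> r l"
  using continuous_on_tendsto_compose[OF residual_continuous assms(3,2)] assms(1) by simp

text \<open>Sequential form of lower semicontinuity: a value \<open>e\<close> strictly between
  \<open>c\<close> and \<open>f l\<close> would be exceeded by \<open>f (x k)\<close> for all large
  \<open>k\<close>, while the bounds \<open>b k\<close> eventually drop below
  \<open>e\<close>.\<close>

lemma penalty_limit_le:
  assumes "\<And>k. x k \<in> S" "l \<in> S" "x \<longlonglongrightarrow> l" "\<And>k. f (x k) \<le> b k" "b \<longlonglongrightarrow> c"
  shows "f l \<le> c"
proof (rule ccontr)
  assume "\<not> f l \<le> c"
  then obtain e where e: "c < e" "e < f l"
    using dense not_le by metis
  obtain U where U: "open U" "{x \<in> S. e < f x} = S \<inter> U"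
    using penalty_lsc[of e] by (auto simp: openin_open)
  then have "\<forall>\<^sub>F k in sequentially. x k \<in> U"
    using assms(2,3) e by (intro topological_tendstoD) auto
  then have "\<forall>\<^sub>F k in sequentially. e < f (x k)"
    by eventually_elim (use U(2) assms(1) in blast)
  moreover have "\<forall>\<^sub>F k in sequentially. b k < e"
    using assms(5) e(1) by (rule order_tendstoD)
  ultimately have "\<forall>\<^sub>F k in sequentially. False"
    by eventually_elim (use assms(4) in \<open>meson less_trans not_le\<close>)
  then show False by simp
qed

lemma bounded_sequence_subseq:
  assumes "\<And>k. x k \<in> S" "0 < \<beta>" "\<And>k. J \<beta> (x k) \<le> \<rho>"
  obtains l s where "l \<in> S" "strict_mono (s :: nat \<Rightarrow> nat)" "(x \<circ> s) \<longlonglongrightarrow> l"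
proof -
  \<comment> \<open>The maximum with 1 makes the level positive, as \<open>sublevel_compact\<close>
    demands.\<close>
  have "compact {x \<in> S. J \<beta> x \<le> max \<rho> 1}"
    unfolding J_def using assms(2) by (intro sublevel_compact) auto
  moreover have "\<forall>k. x k \<in> {x \<in> S. J \<beta> x \<le> max \<rho> 1}"
    using assms(1,3) by (simp add: le_max_iff_disj)
  ultimately show ?thesis
    using that unfolding compact_def by (metis (no_types, lifting) mem_Collect_eq)
qed

text \<open>Compactness and lower semicontinuity with a moving parameter. The common lower bound
  \<beta> puts the whole sequence into one compact sublevel set. With a constant parameter this
  serves the existence of minimizers, with a convergent one their stability.\<close>

lemma J_limit_le:
  assumes x: "\<And>k. x k \<in> S" and \<beta>: "0 < \<beta>" "\<And>k. \<beta> \<le> \<alpha> k" and \<alpha>: "\<alpha> \<longlonglongrightarrow> a"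
    and J: "\<And>k. J (\<alpha> k) (x k) \<le> c k" and c: "c \<longlonglongrightarrow> C"
  obtains l s where "l \<in> S" "strict_mono (s :: nat \<Rightarrow> nat)" "(x \<circ> s) \<longlonglongrightarrow> l" "J a l \<le> C"
proof -
  obtain \<rho> where \<rho>: "\<And>k. c k \<le> \<rho>"
    using convergent_imp_bounded[OF c] by (force simp: bounded_iff abs_le_iff)
  have J_le: "J \<beta> (x k) \<le> \<rho>" for k
    using J_mono[OF x \<beta>(2)] J \<rho> by (meson order_trans)
  obtain l s where l: "l \<in> S" and s: "strict_mono (s :: nat \<Rightarrow> nat)" and lim: "(x \<circ> s) \<longlonglongrightarrow> l"
    by (rule bounded_sequence_subseq[OF x \<beta>(1) J_le])
  have a: "0 < a"
    using \<beta> LIMSEQ_le_const[OF \<alpha>, of \<beta>] by (meson less_le_trans)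
  have "(\<lambda>k. r ((x \<circ> s) k)) \<longlonglongrightarrow> r l"
    by (rule residual_tendsto[OF _ l lim]) (simp add: x)
  then have "(\<lambda>k. r ((x \<circ> s) k) powr p) \<longlonglongrightarrow> r l powr p"
    using exponent_pos x residual_nonneg by (intro tendsto_powr2) auto
  moreover have "(\<lambda>k. c (s k)) \<longlonglongrightarrow> C" "(\<lambda>k. \<alpha> (s k)) \<longlonglongrightarrow> a"
    using LIMSEQ_subseq_LIMSEQ[OF c s] LIMSEQ_subseq_LIMSEQ[OF \<alpha> s] by (simp_all add: o_def)
  \<comment> \<open>The residual converges but the penalty is only lower semicontinuous, so the
    inequality for \<open>J\<close> is solved for \<open>f\<close> before passing to the
    limit.\<close>
  ultimately have bnd:
    "(\<lambda>k. (c (s k) - r ((x \<circ> s) k) powr p) / \<alpha> (s k)) \<longlonglongrightarrow> (C - r l powr p) / a"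
    using a by (intro tendsto_divide tendsto_diff) auto
  have f_le: "f ((x \<circ> s) k) \<le> (c (s k) - r ((x \<circ> s) k) powr p) / \<alpha> (s k)" for k
    using J[of "s k"] \<beta>(1) \<beta>(2)[of "s k"] by (simp add: J_def field_simps)
  have "f l \<le> (C - r l powr p) / a"
    by (rule penalty_limit_le[OF _ l lim f_le bnd]) (simp add: x)
  then have "J a l \<le> C"
    using a by (simp add: J_def field_simps)
  then show ?thesis
    by (rule that[OF l s lim])
qed

lemma minimizer_exists:
  assumes "0 < \<alpha>"
  shows "minimizers S (J \<alpha>) \<noteq> {}"
proof -
  define I where "I = (INF x\<in>S. J \<alpha> x)"
  have bdd: "bdd_below (J \<alpha> ` S)"
    using J_nonneg assms by (intro bdd_belowI2[of _ 0]) auto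
  have "\<exists>x\<in>S. J \<alpha> x < I + 1 / real (Suc k)" for k
    using cINF_less_iff[OF _ bdd, of "I + 1 / real (Suc k)"] x0_in by (auto simp: I_def)
  then obtain x where x: "\<And>k. x k \<in> S" "\<And>k. J \<alpha> (x k) < I + 1 / real (Suc k)"
    by metis
  have "(\<lambda>k. I + 1 / real (Suc k)) \<longlonglongrightarrow> I"
    using LIMSEQ_inverse_real_of_nat_add[of I] by (simp add: inverse_eq_divide)
  then obtain l where "l \<in> S" "J \<alpha> l \<le> I"
    by (rule J_limit_le[OF x(1) assms order_refl tendsto_const less_imp_le[OF x(2)]])
  then have "l \<in> minimizers S (J \<alpha>)"
    using cINF_lower[OF bdd] by (force simp: minimizers_iff I_def)
  then show ?thesis by blast
qed

text \<open>Each \<open>x k\<close> is compared with one fixed minimizer \<open>z\<close> for the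
  limit parameter. As \<open>J (\<alpha> k) z\<close> tends to \<open>J a z\<close>, a subsequential
  limit is no worse than \<open>z\<close>.\<close>

lemma minimizers_limit:
  assumes \<beta>: "0 < \<beta>" "\<And>k. \<beta> \<le> \<alpha> k" and \<alpha>: "\<alpha> \<longlonglongrightarrow> a"
    and x: "\<And>k. x k \<in> minimizers S (J (\<alpha> k))"
  obtains l and s :: "nat \<Rightarrow> nat" where "l \<in> minimizers S (J a)"
    "(\<lambda>k. r (x (s k))) \<longlonglongrightarrow> r l"
proof -
  have xS: "x k \<in> S" for k
    using x by (simp add: minimizers_iff)
  have Jz: "(\<lambda>k. J (\<alpha> k) z) \<longlonglongrightarrow> J a z" for z
    unfolding J_def by (intro tendsto_intros \<alpha>)
  obtain z where z: "z \<in> minimizers S (J a)"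
    using minimizer_exists[of a] LIMSEQ_le_const[OF \<alpha>, of \<beta>] \<beta> by (meson ex_in_conv less_le_trans)
  then have J_le: "J (\<alpha> k) (x k) \<le> J (\<alpha> k) z" for k
    using x by (simp add: minimizers_iff)
  obtain l s where l: "l \<in> S" "strict_mono (s :: nat \<Rightarrow> nat)" "(x \<circ> s) \<longlonglongrightarrow> l" "J a l \<le> J a z"
    by (rule J_limit_le[OF xS \<beta> \<alpha> J_le Jz])
  have "l \<in> minimizers S (J a)"
    using l(1,4) z by (force simp: minimizers_iff)
  moreover have "(\<lambda>k. r (x (s k))) \<longlonglongrightarrow> r l"
    using residual_tendsto[of "x \<circ> s" l] xS l by simp
  ultimately show ?thesis
    by (rule that)
qed

lemma residual_small_for_small_parameter:
  assumes z: "z \<in> S" "r z < T"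
  shows "\<exists>\<alpha>>0. \<forall>x\<in>minimizers S (J \<alpha>). r x < T"
proof -
  have gap: "0 < T powr p - r z powr p"
    using z residual_nonneg exponent_pos by (simp add: powr_less_mono2)
  \<comment> \<open>Chosen so that \<open>J \<alpha> z\<close> stays strictly below
    \<open>T powr p\<close>; the \<open>+ 1\<close> keeps the denominator positive and the
    inequality strict.\<close>
  define \<alpha> where "\<alpha> = (T powr p - r z powr p) / (f z + 1)"
  have fz: "0 \<le> f z"
    using z(1) penalty_nonneg by simp
  have \<alpha>: "0 < \<alpha>"
    using gap fz by (simp add: \<alpha>_def)
  have "\<alpha> * f z < \<alpha> * (f z + 1)"
    using \<alpha> by simp
  also have "\<dots> = T powr p - r z powr p"
    using fz by (simp add: \<alpha>_def)
  finally have Jz: "J \<alpha> z < T powr p"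
    by (simp add: J_def)
  have "r x < T" if x: "x \<in> minimizers S (J \<alpha>)" for x
  proof (rule ccontr)
    assume "\<not> r x < T"
    then have "T powr p \<le> r x powr p"
      using z residual_nonneg[OF z(1)] exponent_pos by (intro powr_mono2) auto
    also have "\<dots> \<le> J \<alpha> x"
      using x \<alpha> penalty_nonneg by (simp add: J_def minimizers_iff)
    also have "\<dots> \<le> J \<alpha> z"
      using x z(1) by (simp add: minimizers_iff)
    finally show False
      using Jz by simp
  qed
  with \<alpha> show ?thesis by blast
qed

text \<open>Comparison with \<open>x0\<close>, which has zero penalty, bounds the penalty of a
  minimizer by a constant over \<alpha>. Minimizers for parameters tending to infinity thus
  accumulate at \<open>x0\<close>, whose residual exceeds \<open>T\<close>.\<close>

lemma residual_large_for_large_parameter: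
  assumes T: "T < r x0"
  shows "\<exists>b. \<forall>\<alpha>>b. \<forall>x\<in>minimizers S (J \<alpha>). T < r x"
proof (rule ccontr)
  assume "\<not> ?thesis"
  then have "\<forall>k::nat. \<exists>\<alpha> x. real (Suc k) < \<alpha> \<and> x \<in> minimizers S (J \<alpha>) \<and> r x \<le> T"
    by (meson not_le)
  then obtain \<alpha> x where \<alpha>: "\<And>k::nat. real (Suc k) < \<alpha> k"
    and x: "\<And>k. x k \<in> minimizers S (J (\<alpha> k))" and rx: "\<And>k. r (x k) \<le> T"
    by metis
  define C where "C = r x0 powr p"
  have xS: "x k \<in> S" for k
    using x by (simp add: minimizers_iff)
  have "f x0 = 0"
    using penalty_zero_iff x0_in by simp
  then have J: "J (\<alpha> k) (x k) \<le> C" for k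
    using x[of k] x0_in by (auto simp: minimizers_iff J_def C_def dest: bspec[of _ _ x0])
  have J': "J (real (Suc k)) (x k) \<le> C" for k
    using J_mono[OF xS less_imp_le[OF \<alpha>]] J by (meson order_trans)
  \<comment> \<open>All parameters exceed 1, so one sublevel set of \<open>J 1\<close> supplies the
    compactness.\<close>
  have J_le: "J 1 (x k) \<le> C" for k
    using J_mono[OF xS, of 1 "real (Suc k)" k] J'[of k] by simp
  obtain l s where l: "l \<in> S" "strict_mono (s :: nat \<Rightarrow> nat)" "(x \<circ> s) \<longlonglongrightarrow> l"
    by (rule bounded_sequence_subseq[OF xS zero_less_one J_le])
  have "(\<lambda>k. C / real (Suc k)) \<longlonglongrightarrow> 0"
    using tendsto_mult_right_zero[OF LIMSEQ_inverse_real_of_nat, of C] by (simp add: divide_inverse)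
  then have lim0: "(\<lambda>k. C / real (Suc (s k))) \<longlonglongrightarrow> 0"
    using LIMSEQ_subseq_LIMSEQ[OF _ l(2)] by (fastforce simp: o_def)
  have "f (x k) \<le> C / real (Suc k)" for k
  proof -
    have "real (Suc k) * f (x k) \<le> J (real (Suc k)) (x k)"
      by (simp add: J_def)
    with J'[of k] show ?thesis
      by (simp add: pos_le_divide_eq mult.commute)
  qed
  then have "f l \<le> 0"
    using xS by (intro penalty_limit_le[OF _ l(1,3) _ lim0]) auto
  then have "l = x0"
    using penalty_nonneg penalty_zero_iff l(1) by (meson order_antisym)
  moreover have "r l \<le> T"
    using residual_tendsto[of "x \<circ> s" l] xS l rx by (intro LIMSEQ_le_const2) auto
  ultimately show False
    using T by simp
qed

lemma residual_between:
  assumes z: "z \<in> S" "r z < T" and T: "T < r x0"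
    and no_jump: "\<And>\<alpha> u v. 0 < \<alpha> \<Longrightarrow> u \<in> minimizers S (J \<alpha>) \<Longrightarrow> v \<in> minimizers S (J \<alpha>) \<Longrightarrow>
      r u < T \<Longrightarrow> r v \<le> T\<^sub>2"
    and "T \<le> T\<^sub>2"
  shows "\<exists>\<alpha>>0. \<exists>x\<in>minimizers S (J \<alpha>). T \<le> r x \<and> r x \<le> T\<^sub>2"
proof (rule ccontr)
  assume "\<not> ?thesis"
  then have gap: "r x < T \<or> T\<^sub>2 < r x" if "0 < \<alpha>" "x \<in> minimizers S (J \<alpha>)" for \<alpha> x
    using that by (meson not_le)
  \<comment> \<open>A single minimizer below \<open>T\<close> suffices for membership. Outside
    \<open>L\<close>, \<open>gap\<close> therefore forces every minimizer for a positive parameter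
    above \<open>T\<^sub>2\<close>.\<close>
  define L where "L = {\<alpha>. 0 < \<alpha> \<and> (\<exists>x\<in>minimizers S (J \<alpha>). r x < T)}"
  define a where "a = Sup L"
  obtain \<alpha>\<^sub>0 where "0 < \<alpha>\<^sub>0" "\<forall>x\<in>minimizers S (J \<alpha>\<^sub>0). r x < T"
    using residual_small_for_small_parameter[OF z] by blast
  then have \<alpha>\<^sub>0: "\<alpha>\<^sub>0 \<in> L"
    using minimizer_exists[of \<alpha>\<^sub>0] by (auto simp: L_def)
  obtain b where b: "\<forall>\<alpha>>b. \<forall>x\<in>minimizers S (J \<alpha>). T < r x"
    using residual_large_for_large_parameter[OF T] by blast
  have bdd: "bdd_above L"
  proof (rule bdd_aboveI[of _ b])
    show "\<alpha> \<le> b" if "\<alpha> \<in> L" for \<alpha>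
      using that b by (force simp: L_def not_less[symmetric])
  qed
  have a: "0 < a"
    using cSup_upper[OF \<alpha>\<^sub>0 bdd] \<alpha>\<^sub>0 by (simp add: a_def L_def)
  \<comment> \<open>The shift by 2 keeps the parameters approaching \<open>a\<close> from the left
    at least \<open>a / 2\<close>, the uniform positive bound required by
    \<open>minimizers_limit\<close>.\<close>
  have inv0: "(\<lambda>k. c / real (k + 2)) \<longlonglongrightarrow> 0" for c
    using LIMSEQ_ignore_initial_segment[OF lim_const_over_n, of c 2] by simp

  have "a - a / real (k + 2) < Sup L" for k
    using divide_pos_pos[OF a, of "real (k + 2)"] by (simp add: a_def)
  then have "\<exists>\<alpha>\<in>L. a - a / real (k + 2) < \<alpha>" for k
    using \<alpha>\<^sub>0 by (intro less_cSupD) auto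
  then obtain \<alpha> where \<alpha>: "\<And>k. \<alpha> k \<in> L" "\<And>k. a - a / real (k + 2) < \<alpha> k"
    by metis
  obtain x where x: "\<And>k. x k \<in> minimizers S (J (\<alpha> k))" "\<And>k. r (x k) < T"
    using \<alpha>(1) unfolding L_def by (simp add: Bex_def) metis
  have \<alpha>_lower: "a / 2 \<le> \<alpha> k" for k
  proof -
    have "a / real (k + 2) \<le> a / 2"
      using a by (intro divide_left_mono) auto
    then show ?thesis
      using \<alpha>(2)[of k] by simp
  qed
  have \<alpha>_lim: "\<alpha> \<longlonglongrightarrow> a"
  proof (rule tendsto_sandwich)
    show "(\<lambda>k. a - a / real (k + 2)) \<longlonglongrightarrow> a"
      using tendsto_diff[OF tendsto_const inv0, of a a] by simp
    show "\<forall>\<^sub>F k in sequentially. a - a / real (k + 2) \<le> \<alpha> k"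
      using \<alpha>(2) by (intro always_eventually allI less_imp_le)
    show "\<forall>\<^sub>F k in sequentially. \<alpha> k \<le> a"
      using cSup_upper[OF \<alpha>(1) bdd] by (simp add: a_def)
  qed simp
  obtain u s where u: "u \<in> minimizers S (J a)" "(\<lambda>k. r (x (s k))) \<longlonglongrightarrow> r u"
    by (rule minimizers_limit[OF half_gt_zero[OF a] \<alpha>_lower \<alpha>_lim x(1)])
  have "r u \<le> T"
    using LIMSEQ_le_const2[OF u(2)] x(2) less_imp_le by blast
  \<comment> \<open>The limit only gives \<open>r u \<le> T\<close>; the empty band between
    \<open>T\<close> and \<open>T\<^sub>2\<close> makes this strict. The same happens for
    \<open>v\<close> at \<open>T\<^sub>2\<close>.\<close>
  with gap[OF a u(1)] \<open>T \<le> T\<^sub>2\<close> have "r u < T" by auto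

  define \<beta> where "\<beta> k = a + 1 / real (k + 2)" for k
  have \<beta>: "a < \<beta> k" for k
    by (simp add: \<beta>_def)
  then have \<beta>_pos: "0 < \<beta> k" for k
    using a less_trans by blast
  have "\<exists>x. x \<in> minimizers S (J (\<beta> k))" for k
    using minimizer_exists[OF \<beta>_pos] by blast
  then obtain w where w: "\<And>k. w k \<in> minimizers S (J (\<beta> k))"
    by metis
  have "\<beta> k \<notin> L" for k
    using cSup_upper[OF _ bdd] \<beta>[of k] by (force simp: a_def)
  then have rw: "T\<^sub>2 < r (w k)" for k
    using gap[OF \<beta>_pos w] \<beta>_pos w by (force simp: L_def)
  have \<beta>_lim: "\<beta> \<longlonglongrightarrow> a"
    using tendsto_add[OF tendsto_const inv0, of a 1] by (simp add: \<beta>_def[abs_def])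
  obtain v s' where v: "v \<in> minimizers S (J a)" "(\<lambda>k. r (w (s' k))) \<longlonglongrightarrow> r v"
    by (rule minimizers_limit[OF a less_imp_le[OF \<beta>] \<beta>_lim w])
  have "T\<^sub>2 \<le> r v"
    using LIMSEQ_le_const[OF v(2)] rw less_imp_le by blast
  with gap[OF a v(1)] \<open>T \<le> T\<^sub>2\<close> have "T\<^sub>2 < r v" by auto
  with no_jump[OF a u(1) v(1)] \<open>r u < T\<close> show False by simp
qed

end

section \<open>Discretization and choice of the level\<close>

text \<open>A point of some \<open>D n\<close> close to \<open>x\<close> belongs to all later
  \<open>D m\<close>, and the nearest point is at least as close.\<close>

lemma projection_tendsto:
  assumes P: "\<And>m. is_projection_onto (D m) (P m)" and "incseq D" and x: "x \<in> closure (\<Union>m. D m)"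
  shows "(\<lambda>m. P m x) \<longlonglongrightarrow> x"
proof (rule tendstoI)
  fix e :: real
  assume "0 < e"
  with x obtain n z where z: "z \<in> D n" "dist z x < e"
    by (auto simp: closure_approachable)
  have "dist (P m x) x < e" if "n \<le> m" for m
  proof -
    have "z \<in> D m"
      using z(1) \<open>incseq D\<close> that by (auto simp: incseq_def)
    then have "dist x (P m x) \<le> dist x z"
      using P by (auto simp: is_projection_onto_def)
    then show ?thesis
      using z(2) by (simp add: dist_commute)
  qed
  then show "\<forall>\<^sub>F m in sequentially. dist (P m x) x < e"
    by (auto simp: eventually_sequentially)
qed

theorem proposition1:
  fixes F :: "'a::banach \<Rightarrow> 'b::banach"
    and DF Df :: "'a set"
    and f :: "'a \<Rightarrow> real"
    and p \<delta> \<tau> \<tau>\<^sub>2 lam :: real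
    and y yd :: 'b
    and x0 xdag :: 'a
    and X :: "nat \<Rightarrow> 'a set"
    and D :: "nat \<Rightarrow> 'a set"
    and P :: "nat \<Rightarrow> 'a \<Rightarrow> 'a"
    and \<gamma> :: "nat \<Rightarrow> real"
    and M :: "real \<Rightarrow> nat \<Rightarrow> 'a set"
    and m0 :: nat
  assumes reflexive_X: "reflexive_space TYPE('a)"
    and reflexive_Y: "reflexive_space TYPE('b)"
    and convex_DF: "convex DF"
    and exact_data: "y \<in> F ` DF"
    and noise_level: "0 < \<delta>"
    and noisy_data: "norm (y - yd) \<le> \<delta>"
    and exponent: "1 \<le> p"
    and x0_in_DF: "x0 \<in> DF"
    \<comment> \<open>assumption (1)\<close>
    and f_nonneg: "\<And>x. x \<in> Df \<Longrightarrow> 0 \<le> f x"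
    and f_weakly_lsc: "weakly_lsc_on Df f"
    and f_convex: "convex_on Df f"
    and f_coercive: "coercive_on Df f"
    and f_proper: "proper_on Df f"
    and DF_interior: "DF \<subseteq> interior Df"
    \<comment> \<open>assumption (2)\<close>
    and F_continuous: "continuous_on DF F"
    and level_precompact:
      "\<And>\<alpha> \<rho>. 0 < \<alpha> \<Longrightarrow> 0 < \<rho> \<Longrightarrow> weakly_precompact (level_set DF F f p yd \<alpha> \<rho>)"
    and level_closed:
      "\<And>\<alpha> \<rho>. 0 < \<alpha> \<Longrightarrow> 0 < \<rho> \<Longrightarrow> weakly_closed (level_set DF F f p yd \<alpha> \<rho>)"
    and F_weakly_continuous:
      "\<And>\<alpha> \<rho>. 0 < \<alpha> \<Longrightarrow> 0 < \<rho> \<Longrightarrow> weakly_continuous_on (level_set DF F f p yd \<alpha> \<rho>) F"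
    \<comment> \<open>assumption (3)\<close>
    and liminf_zero: "\<And>x. x \<in> f_minimizing_solutions DF F f y \<Longrightarrow>
      Liminf (at_right 0)
        (\<lambda>t. ereal (norm (F ((1 - t) *\<^sub>R x + t *\<^sub>R x0) - y) powr p / t)) = 0"
    and xdag: "xdag \<in> f_minimizing_solutions DF F f y"
    \<comment> \<open>discretization\<close>
    and X_finite_dim: "\<And>m. \<exists>B. finite B \<and> X m = span B"
    and X_mono: "\<And>m. X m \<subseteq> X (Suc m)"
    and X_dense: "closure (\<Union>m. X m) = UNIV"
    and D_def: "\<And>m. D m = DF \<inter> X m"
    and D_nonempty: "\<And>m. D m \<noteq> {}"
    and P_projection: "\<And>m. is_projection_onto (D m) (P m)"
    and \<gamma>_def: "\<And>m. \<gamma> m = norm (F xdag - F (P m xdag))"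
    and M_def: "\<And>\<alpha> m. M \<alpha> m = minimizers (D m) (tikhonov F f p yd \<alpha>)"
    \<comment> \<open>further standing assumptions\<close>
    and f_zero_iff: "\<And>x. x \<in> Df \<Longrightarrow> f x = 0 \<longleftrightarrow> x = x0"
    and x0_in_D: "x0 \<in> D m0"
    and tau: "1 < \<tau>" "\<tau> < lam"
    and tau2: "\<tau> \<le> \<tau>\<^sub>2" "\<tau>\<^sub>2 < lam"
    and no_jump: "\<And>m. m0 \<le> m \<Longrightarrow>
      \<not> (\<exists>\<alpha>>0. \<exists>xl\<in>M \<alpha> m. \<exists>xu\<in>M \<alpha> m.
          norm (F xl - yd) < \<tau> * (\<delta> + \<gamma> m) \<and>
          \<tau> * (\<delta> + \<gamma> m) \<le> \<tau>\<^sub>2 * (\<delta> + \<gamma> m) \<and>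
          \<tau>\<^sub>2 * (\<delta> + \<gamma> m) < norm (F xu - yd))"
    \<comment> \<open>nondegeneracy: neither follows from the assumptions above, and without either one the
      conclusion can fail\<close>
    and x0_misfit: "\<tau> * \<delta> < norm (F x0 - yd)"
    and D_approximates: "xdag \<in> closure (\<Union>m. D m)"
  shows "\<exists>m\<ge>m0. \<exists>\<alpha>>0. \<exists>x\<in>M \<alpha> m.
           \<tau> * \<delta> \<le> norm (F x - yd) \<and> norm (F x - yd) \<le> lam * \<delta>"
proof -
  have xd: "xdag \<in> DF" "F xdag = y"
    using xdag by (auto simp: f_minimizing_solutions_def minimizers_def is_arg_min_def
        least_square_solutions_def)
  have DF_Df: "DF \<subseteq> Df"
    using DF_interior interior_subset by blast
  have "incseq X"
    using X_mono by (rule incseq_SucI)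
  then have inc: "incseq D"
    by (auto simp: incseq_def D_def)
  have PD: "P m x \<in> D m" for m x
    using P_projection by (simp add: is_projection_onto_def)
  have "(\<lambda>m. F (P m xdag)) \<longlonglongrightarrow> F xdag"
    using continuous_on_tendsto_compose[OF F_continuous
        projection_tendsto[OF P_projection inc D_approximates] xd(1)] PD
    by (simp add: D_def)
  then have "(\<lambda>m. norm (F xdag - F (P m xdag))) \<longlonglongrightarrow> norm (F xdag - F xdag)"
    by (intro tendsto_intros)
  then have \<gamma>0: "\<gamma> \<longlonglongrightarrow> 0"
    by (simp add: \<gamma>_def[abs_def])
  have lim: "(\<lambda>m. c * (\<delta> + \<gamma> m)) \<longlonglongrightarrow> c * \<delta>" for c
    using tendsto_mult_left[OF tendsto_add[OF tendsto_const \<gamma>0], of c \<delta>] by simp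
  have "\<tau>\<^sub>2 * \<delta> < lam * \<delta>"
    using tau2(2) noise_level by simp
  \<comment> \<open>As \<open>\<gamma> m\<close> vanishes, the strict inequalities
    \<open>\<tau>\<^sub>2 < lam\<close> and \<open>x0_misfit\<close> absorb it for large
    \<open>m\<close>.\<close>
  then have "\<forall>\<^sub>F m in sequentially. m0 \<le> m \<and> \<tau>\<^sub>2 * (\<delta> + \<gamma> m) < lam * \<delta> \<and>
      \<tau> * (\<delta> + \<gamma> m) < norm (F x0 - yd)"
    by (intro eventually_conj eventually_ge_at_top order_tendstoD(2)[OF lim] x0_misfit)
  then obtain m where m: "m0 \<le> m" "\<tau>\<^sub>2 * (\<delta> + \<gamma> m) < lam * \<delta>"
      "\<tau> * (\<delta> + \<gamma> m) < norm (F x0 - yd)"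
    using eventually_happens'[OF sequentially_bot] by blast
  have \<gamma>_nonneg: "0 \<le> \<gamma> m"
    by (simp add: \<gamma>_def)
  obtain B where B: "finite B" "X m = span B"
    using X_finite_dim by blast
  have Dm_Df: "D m \<subseteq> Df" and Dm_DF: "D m \<subseteq> DF"
    using DF_Df by (auto simp: D_def)

  interpret regularized_problem "D m" "\<lambda>x. norm (F x - yd)" f p x0
  proof
    show "0 < p"
      using exponent by simp
    show "continuous_on (D m) (\<lambda>x. norm (F x - yd))"
      using continuous_on_subset[OF F_continuous Dm_DF] by (intro continuous_intros)
    show "openin (top_of_set (D m)) {x \<in> D m. c < f x}" for c
      using f_weakly_lsc Dm_Df by (rule weakly_lsc_on_imp_openin)
    show "x0 \<in> D m"
      using x0_in_D inc m(1) by (auto simp: incseq_def)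
    fix \<alpha> \<rho> :: real
    assume \<alpha>: "0 < \<alpha>" and \<rho>: "0 < \<rho>"
    let ?N = "level_set DF F f p yd \<alpha> \<rho>"
    have "f x \<le> \<rho> / \<alpha>" if "x \<in> ?N" for x
    proof -
      have "\<alpha> * f x \<le> tikhonov F f p yd \<alpha> x"
        by (simp add: tikhonov_def)
      also have "\<dots> \<le> \<rho>"
        using that by (simp add: level_set_def)
      finally show ?thesis
        using \<alpha> by (simp add: pos_le_divide_eq mult.commute)
    qed
    then have "?N \<subseteq> {x \<in> Df. f x \<le> \<rho> / \<alpha>}"
      using DF_Df by (auto simp: level_set_def)
    then have "bounded ?N"
      using coercive_on_imp_bounded_sublevel[OF f_coercive] bounded_subset by blast
    then obtain R where R: "?N \<subseteq> cball 0 R"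
      by (auto simp: bounded_iff mem_cball_0 subset_iff)
    \<comment> \<open>Coercivity supplies the ball, finite dimension its compactness within the
      span, and weak closedness the norm closedness of \<open>?N\<close>.\<close>
    have "compact ((cball 0 R \<inter> span B) \<inter> ?N)"
      using compact_cball_Int_span[OF B(1)] weakly_closed_imp_closed[OF level_closed[OF \<alpha> \<rho>]]
      by (rule compact_Int_closed)
    also have "(cball 0 R \<inter> span B) \<inter> ?N =
        {x \<in> D m. norm (F x - yd) powr p + \<alpha> * f x \<le> \<rho>}"
      using R B(2) by (auto simp: D_def level_set_def tikhonov_def)
    finally show "compact {x \<in> D m. norm (F x - yd) powr p + \<alpha> * f x \<le> \<rho>}" .
  qed (use f_nonneg f_zero_iff Dm_Df in auto)

  have J_eq: "J \<alpha> = tikhonov F f p yd \<alpha>" for \<alpha>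
    by (simp add: J_def tikhonov_def fun_eq_iff)
  have mono: "\<tau> * (\<delta> + \<gamma> m) \<le> \<tau>\<^sub>2 * (\<delta> + \<gamma> m)"
    using tau2(1) noise_level \<gamma>_nonneg by (intro mult_right_mono) auto
  \<comment> \<open>\<open>P m xdag\<close> is the comparison point for small \<alpha>: its residual
    is at most \<open>\<delta> + \<gamma> m\<close>, and \<open>\<tau> > 1\<close> makes the
    threshold strictly larger.\<close>
  have "norm (F (P m xdag) - yd) \<le> norm (F (P m xdag) - F xdag) + norm (y - yd)"
    using norm_triangle_ineq[of "F (P m xdag) - F xdag" "y - yd"] by (simp add: xd(2))
  also have "\<dots> \<le> \<delta> + \<gamma> m"
    using noisy_data by (simp add: \<gamma>_def norm_minus_commute)
  also have "\<dots> < \<tau> * (\<delta> + \<gamma> m)"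
    using tau(1) noise_level \<gamma>_nonneg by simp
  finally have "norm (F (P m xdag) - yd) < \<tau> * (\<delta> + \<gamma> m)" .
  moreover have "norm (F v - yd) \<le> \<tau>\<^sub>2 * (\<delta> + \<gamma> m)"
    if "0 < \<alpha>" "u \<in> minimizers (D m) (J \<alpha>)" "v \<in> minimizers (D m) (J \<alpha>)"
      "norm (F u - yd) < \<tau> * (\<delta> + \<gamma> m)" for \<alpha> u v
    using no_jump[OF m(1)] that mono by (force simp: M_def J_eq)
  ultimately obtain \<alpha> x where "0 < \<alpha>" and x: "x \<in> M \<alpha> m"
      "\<tau> * (\<delta> + \<gamma> m) \<le> norm (F x - yd)" "norm (F x - yd) \<le> \<tau>\<^sub>2 * (\<delta> + \<gamma> m)"
    using residual_between[OF PD[of m xdag] _ m(3) _ mono] by (auto simp: M_def J_eq)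
  moreover have "\<tau> * \<delta> \<le> \<tau> * (\<delta> + \<gamma> m)"
    using tau(1) \<gamma>_nonneg by (intro mult_left_mono) auto
  ultimately show ?thesis
    using m(1,2) by (intro exI[of _ m] conjI exI[of _ \<alpha>] bexI[of _ x]) auto
qed

end
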